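(* Let $G = (V, E)$ be a hypergraph with a linear order $<$ on the edge set $E$, let $\mathcal{B} \subseteq \mathcal{B}(G, <)$ be a subset of the set of all broken cycles of $G$ with respect to $<$, and let $f(G, A)$, defined for $A \subseteq E$, be a function to an additive abelian group such that for all $A \subseteq E$ and all $e \in E \setminus A$ it holds that $$k(G\langle A\rangle) = k(G\langle A \cup \{e\}\rangle) \;\Rightarrow\; f(G, A) = - f(G, A \cup \{e\}).$$ Then $$\sum_{A \subseteq E} f(G, A) = \sum_{\substack{A \subseteq E \\ \forall B \in \mathcal{B} \colon B \nsubseteq A}} f(G, A).$$
   Context: A hypergraph $G = (V, E)$ is an ordered pair of a finite vertex set $V$ and a finite multiset $E$ of edges, each edge being a non-empty subset of $V$. Parallel edges are thus allowed, and edges with one vertex are allowed. Parallel copies count as distinct elements of $E$, so that subsets of $E$, their cardinalities and linear orders on $E$ refer to edge occurrences. A hypergraph $G' = (V', E')$ is a subgraph of $G$ if $V' \subseteq V$ and $E' \subseteq E$ (being a hypergraph, $G'$ has $e \subseteq V'$ for every $e \in E'$). For $A \subseteq E$, $G\langle A\rangle = (V, A)$ is the spanning subgraph with edge set $A$. $G_{-e}$ denotes the hypergraph obtained from $G$ by deleting the edge $e$ (keeping all vertices). $k(G)$ denotes the number of connected components of $G$, i.e. the number of classes of the equivalence relation on $V$ generated by relating any two vertices that lie in a common edge (so isolated vertices count as components). $G$ is $\delta$-cyclic if it has a subgraph $G' = (V', E')$ including at least one edge such that $k(G') = k(G'_{-e})$ for each edge $e \in E'$. $G$ is a $\delta$-cycle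 if it is $\delta$-cyclic and has no proper $\delta$-cyclic subgraph. Given a linear order $<$ on $E$, let $C = (V_C, E_C)$ be a subgraph of $G$ that is a $\delta$-cycle and let $e \in E_C$ be the maximal edge of $C$ with respect to $<$. Then $E_C \setminus \{e\}$ is called a broken cycle in $G$ with respect to $<$. $\mathcal{B}(G, <)$ denotes the set of all broken cycles of $G$ with respect to $<$. *)

theory Defs
  imports Main
begin

text \<open>
  The multiset of edges is given as a finite set of edge occurrences \<open>edges G\<close> together with an
  incidence map \<open>ends G\<close> sending an occurrence to its set of vertices. Parallel edges are distinct
  occurrences with the same \<open>ends\<close>, so subsets of and orders on \<open>edges G\<close> refer to occurrences.
\<close>

record ('v, 'e) pre_hypergraph =
  verts :: "'v set"
  edges :: "'e set"
  ends :: "'e \<Rightarrow> 'v set"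

definition hypergraph :: "('v, 'e) pre_hypergraph \<Rightarrow> bool" where
  "hypergraph G \<longleftrightarrow> finite (verts G) \<and> finite (edges G) \<and>
     (\<forall>e\<in>edges G. ends G e \<noteq> {} \<and> ends G e \<subseteq> verts G)"

text \<open>
  A subgraph keeps the whole incidence map, including its irrelevant values outside the edge set.
  Hence two subgraphs of \<open>G\<close> are equal as records iff they have the same vertices and edges.
\<close>

definition subgraph :: "('v, 'e) pre_hypergraph \<Rightarrow> ('v, 'e) pre_hypergraph \<Rightarrow> bool" where
  "subgraph G' G \<longleftrightarrow> hypergraph G' \<and> verts G' \<subseteq> verts G \<and> edges G' \<subseteq> edges G \<and> ends G' = ends G"

definition proper_subgraph :: "('v, 'e) pre_hypergraph \<Rightarrow> ('v, 'e) pre_hypergraph \<Rightarrow> bool" where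
  "proper_subgraph G' G \<longleftrightarrow> subgraph G' G \<and> G' \<noteq> G"

definition spanning_subgraph :: "('v, 'e) pre_hypergraph \<Rightarrow> 'e set \<Rightarrow> ('v, 'e) pre_hypergraph" where
  "spanning_subgraph G A = G\<lparr>edges := A\<rparr>"

definition delete_edge :: "('v, 'e) pre_hypergraph \<Rightarrow> 'e \<Rightarrow> ('v, 'e) pre_hypergraph" where
  "delete_edge G e = G\<lparr>edges := edges G - {e}\<rparr>"

definition adjacent :: "('v, 'e) pre_hypergraph \<Rightarrow> 'v \<Rightarrow> 'v \<Rightarrow> bool" where
  "adjacent G u v \<longleftrightarrow> (\<exists>e\<in>edges G. u \<in> ends G e \<and> v \<in> ends G e)"

text \<open>
  The closure \<open>equivclp\<close> is reflexive on the whole vertex type, hence the restriction to \<open>verts G\<close>.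
\<close>

definition connected_rel :: "('v, 'e) pre_hypergraph \<Rightarrow> ('v \<times> 'v) set" where
  "connected_rel G = {(u, v). u \<in> verts G \<and> v \<in> verts G \<and> equivclp (adjacent G) u v}"

definition num_components :: "('v, 'e) pre_hypergraph \<Rightarrow> nat" where
  "num_components G = card (verts G // connected_rel G)"

lemma equiv_connected_rel: "equiv (verts G) (connected_rel G)"
  by (rule equivI)
    (auto simp: connected_rel_def refl_on_def sym_def trans_def
      intro: equivclp_sym equivclp_trans)

lemma connected_rel_least:
  assumes R: "equiv (verts G) R"
    and adj: "\<And>u v. adjacent G u v \<Longrightarrow> (u, v) \<in> R"
  shows "connected_rel G \<subseteq> R"
proof -
  have "(u, v) \<in> R" if "equivclp (adjacent G) u v" "u \<in> verts G" for u v
    using that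
  proof (induction rule: equivclp_induct)
    case base
    then show ?case using R by (simp add: equiv_def refl_on_def)
  next
    case (step y z)
    then have "(y, z) \<in> R" using adj R by (auto simp: equiv_def sym_def)
    then show ?case using step R by (auto simp: equiv_def dest: transD)
  qed
  then show ?thesis by (auto simp: connected_rel_def)
qed

definition delta_cyclic :: "('v, 'e) pre_hypergraph \<Rightarrow> bool" where
  "delta_cyclic G \<longleftrightarrow> (\<exists>G'. subgraph G' G \<and> edges G' \<noteq> {} \<and>
     (\<forall>e\<in>edges G'. num_components G' = num_components (delete_edge G' e)))"

definition delta_cycle :: "('v, 'e) pre_hypergraph \<Rightarrow> bool" where
  "delta_cycle G \<longleftrightarrow> delta_cyclic G \<and> \<not> (\<exists>G'. proper_subgraph G' G \<and> delta_cyclic G')"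

text \<open>The linear order is given as a strict one: \<open>(e, e') \<in> r\<close> stands for \<open>e < e'\<close>.\<close>

definition broken_cycles :: "('v, 'e) pre_hypergraph \<Rightarrow> ('e \<times> 'e) set \<Rightarrow> 'e set set" where
  "broken_cycles G r = {edges C - {e} | C e. subgraph C G \<and> delta_cycle C \<and>
     e \<in> edges C \<and> (\<forall>e'\<in>edges C - {e}. (e', e) \<in> r)}"

end

theory Submission
  imports Defs
begin

text \<open>
  If \<open>C\<close> is a \<open>\<delta>\<close>-cycle, the witness of its \<open>\<delta>\<close>-cyclicity is \<open>C\<close> itself by minimality, so deleting
  the maximal edge \<open>e\<close> of \<open>C\<close> disconnects nothing. Hence toggling \<open>e\<close> in a set \<open>A\<close> containing the
  broken cycle \<open>B = E\<^sub>C - {e}\<close> flips the sign of \<open>f\<close>. Now add the broken cycles one at a time, in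
  the order of their closing edges \<open>e\<close>: all edges of \<open>B\<close> and of the earlier broken cycles are below
  \<open>e\<close>, so among the sets which avoid the earlier ones and contain \<open>B\<close>, toggling \<open>e\<close> is a pairing, and
  these sets contribute \<open>0\<close>.
\<close>

text \<open>Sending an \<open>R\<close>-class to the \<open>S\<close>-class around it is onto. Equal
  finite cardinalities make this map injective, so no two \<open>R\<close>-classes merge in
  \<open>S\<close>.\<close>

lemma equiv_eq_if_card_quotient_eq:
  assumes R: "equiv X R" and S: "equiv X S" and "R \<subseteq> S" and "finite X"
    and card: "card (X // R) = card (X // S)"
  shows "R = S"
proof
  have saturate: "S `` (R `` {x}) = S `` {x}" if "x \<in> X" for x
  proof
    show "S `` (R `` {x}) \<subseteq> S `` {x}"
      using \<open>R \<subseteq> S\<close> S by (auto simp: equiv_def dest: transD)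
    show "S `` {x} \<subseteq> S `` (R `` {x})"
      using equiv_class_self[OF R that] by blast
  qed
  have "(\<lambda>Y. S `` Y) ` (X // R) = X // S"
    unfolding quotient_def by (auto simp: saturate image_UN)
  then have inj: "inj_on (\<lambda>Y. S `` Y) (X // R)"
    using card finite_quotient[OF \<open>finite X\<close> equiv_type[OF R]]
    by (intro eq_card_imp_inj_on) simp_all
  show "S \<subseteq> R"
  proof (rule subrelI)
    fix a b assume ab: "(a, b) \<in> S"
    then have X: "a \<in> X" "b \<in> X" using equiv_type[OF S] by blast+
    then have "S `` (R `` {a}) = S `` (R `` {b})"
      using equiv_class_eq[OF S ab] by (simp only: saturate)
    then have "R `` {a} = R `` {b}"
      using inj_onD[OF inj] quotientI[OF X(1)] quotientI[OF X(2)] by blast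
    then show "(a, b) \<in> R" using eq_equiv_class[OF _ R X(2)] by blast
  qed
qed (fact \<open>R \<subseteq> S\<close>)

lemma equivclp_mono:
  assumes "equivclp P x y" and "\<And>u v. P u v \<Longrightarrow> Q u v"
  shows "equivclp Q x y"
  using assms(1)
proof (induction rule: equivclp_induct)
  case (step y z)
  then have "equivclp Q y z" using assms(2) by (meson r_into_equivclp equivclp_sym)
  with step.IH show ?case by (rule equivclp_trans)
qed simp

lemma connected_rel_mono:
  assumes "verts H \<subseteq> verts G" and "edges H \<subseteq> edges G" and "ends H = ends G"
  shows "connected_rel H \<subseteq> connected_rel G"
  using assms by (fastforce simp: connected_rel_def adjacent_def elim!: equivclp_mono)

lemma delta_cycle_delete_edge:
  assumes "delta_cycle C" and "e \<in> edges C"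
  shows "num_components C = num_components (delete_edge C e)"
proof -
  obtain G' where G': "subgraph G' C" "edges G' \<noteq> {}"
    "\<forall>e\<in>edges G'. num_components G' = num_components (delete_edge G' e)"
    using assms(1) by (auto simp: delta_cycle_def delta_cyclic_def)
  \<comment> \<open>\<open>G'\<close> is its own witness, hence \<delta>-cyclic, so it cannot be a
    proper subgraph of \<open>C\<close>.\<close>
  moreover have "subgraph G' G'" using G'(1) by (simp add: subgraph_def)
  ultimately have "delta_cyclic G'" unfolding delta_cyclic_def by blast
  then have "G' = C" using assms(1) G'(1) by (auto simp: delta_cycle_def proper_subgraph_def)
  then show ?thesis using G'(3) assms(2) by blast
qed

text \<open>Deleting \<open>e\<close> can only refine the connectedness relation, and a refinement
  with as many classes is the same relation. Thus equal component counts yield connections through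
  the other edges of \<open>C\<close>.\<close>

lemma delta_cycle_ends_connected:
  assumes "hypergraph C" and "delta_cycle C" and "e \<in> edges C"
    and "u \<in> ends C e" and "v \<in> ends C e"
  shows "(u, v) \<in> connected_rel (delete_edge C e)"
proof -
  let ?D = "delete_edge C e"
  have D: "verts ?D = verts C" by (simp add: delete_edge_def)
  have "connected_rel ?D = connected_rel C"
  proof (rule equiv_eq_if_card_quotient_eq)
    show "equiv (verts C) (connected_rel ?D)" using equiv_connected_rel[of ?D] D by simp
    show "connected_rel ?D \<subseteq> connected_rel C"
      by (rule connected_rel_mono) (auto simp: delete_edge_def)
    show "card (verts C // connected_rel ?D) = card (verts C // connected_rel C)"
      using delta_cycle_delete_edge[OF assms(2,3)] D by (simp add: num_components_def)
  qed (use assms(1) in \<open>simp_all add: equiv_connected_rel hypergraph_def\<close>)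
  moreover have "(u, v) \<in> connected_rel C"
    using assms by (auto simp: connected_rel_def hypergraph_def adjacent_def intro!: r_into_equivclp)
  ultimately show ?thesis by simp
qed

text \<open>The only adjacencies that \<open>e\<close> can add are between its own ends, and these
  are already connected through \<open>edges C - {e}\<close>, which lies in \<open>A\<close>. So
  both graphs have the same connectedness relation.\<close>

lemma num_components_insert_closing_edge:
  assumes G: "hypergraph G" and C: "subgraph C G" "delta_cycle C" and e: "e \<in> edges C"
    and A: "edges C - {e} \<subseteq> A" "A \<subseteq> edges G"
  shows "num_components (spanning_subgraph G A) = num_components (spanning_subgraph G (insert e A))"
proof -
  let ?H = "spanning_subgraph G A" and ?K = "spanning_subgraph G (insert e A)"
  have V: "verts ?H = verts G" "verts ?K = verts G" by (simp_all add: spanning_subgraph_def)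
  have "(u, v) \<in> connected_rel ?H" if uv: "adjacent ?K u v" for u v
  proof -
    obtain e' where e': "e' \<in> insert e A" "u \<in> ends G e'" "v \<in> ends G e'"
      using uv by (auto simp: adjacent_def spanning_subgraph_def)
    show ?thesis
    proof (cases "e' \<in> A")
      case True
      then show ?thesis using G A(2) e'
        by (fastforce simp: connected_rel_def hypergraph_def adjacent_def spanning_subgraph_def
            intro!: r_into_equivclp)
    next
      case False
      \<comment> \<open>Here \<open>e'\<close> is \<open>e\<close> itself.\<close>
      then have "(u, v) \<in> connected_rel (delete_edge C e)"
        using e' C e by (intro delta_cycle_ends_connected) (auto simp: subgraph_def)
      moreover have "connected_rel (delete_edge C e) \<subseteq> connected_rel ?H"
        using C(1) A(1)
        by (intro connected_rel_mono) (auto simp: subgraph_def delete_edge_def spanning_subgraph_def)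
      ultimately show ?thesis by blast
    qed
  qed
  then have "connected_rel ?K \<subseteq> connected_rel ?H"
    using equiv_connected_rel[of ?H] V by (intro connected_rel_least) auto
  moreover have "connected_rel ?H \<subseteq> connected_rel ?K"
    by (rule connected_rel_mono) (auto simp: spanning_subgraph_def)
  ultimately show ?thesis using V by (simp add: num_components_def)
qed

text \<open>Inserting \<open>e\<close> matches the members without \<open>e\<close> to those with
  \<open>e\<close>, and matched values cancel. The sum is split by membership of \<open>e\<close>:
  reindexing all of it by the toggle would only show that twice the sum is \<open>0\<close>, which
  is too weak in a group with elements of order two.\<close>

lemma sum_eq_0_by_toggling:
  fixes f :: "'e set \<Rightarrow> 'g :: ab_group_add"
  assumes "finite \<A>"
    and toggle: "\<And>A. A - {e} \<in> \<A> \<longleftrightarrow> insert e A \<in> \<A>"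
    and neg: "\<And>A. A \<in> \<A> \<Longrightarrow> e \<notin> A \<Longrightarrow> f A = - f (insert e A)"
  shows "(\<Sum>A\<in>\<A>. f A) = 0"
proof -
  let ?N = "{A \<in> \<A>. e \<notin> A}" and ?Y = "{A \<in> \<A>. e \<in> A}"
  have "?Y \<subseteq> insert e ` ?N"
  proof
    fix A assume "A \<in> ?Y"
    then have "A - {e} \<in> ?N" "A = insert e (A - {e})" using toggle[of A] by (auto simp: insert_absorb)
    then show "A \<in> insert e ` ?N" by blast
  qed
  moreover have "insert e ` ?N \<subseteq> ?Y"
  proof (rule image_subsetI)
    fix A assume "A \<in> ?N"
    then show "insert e A \<in> ?Y" using toggle[of A] by simp
  qed
  ultimately have Y: "?Y = insert e ` ?N" by blast
  have "inj_on (insert e) ?N" by (auto intro!: inj_onI dest: insert_ident)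
  then have "(\<Sum>A\<in>?Y. f A) = (\<Sum>A\<in>?N. f (insert e A))"
    unfolding Y by (simp add: sum.reindex)
  also have "\<dots> = - (\<Sum>A\<in>?N. f A)"
    unfolding sum_negf[symmetric] by (intro sum.cong) (auto simp: neg)
  finally have "(\<Sum>A\<in>?N. f A) + (\<Sum>A\<in>?Y. f A) = 0" by simp
  moreover have "(\<Sum>A\<in>\<A>. f A) = (\<Sum>A\<in>?N \<union> ?Y. f A)" by (rule sum.cong) auto
  moreover have "\<dots> = (\<Sum>A\<in>?N. f A) + (\<Sum>A\<in>?Y. f A)"
    using \<open>finite \<A>\<close> by (intro sum.union_disjoint) auto
  ultimately show ?thesis by simp
qed

text \<open>The combinatorial core, free of hypergraphs: \<open>c B\<close> plays the closing edge
  of the broken cycle \<open>B\<close>, and \<open>\<rho>\<close> ranks the edges.\<close>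

lemma sum_subsets_eq_sum_avoiding:
  fixes f :: "'e set \<Rightarrow> 'g :: ab_group_add" and \<rho> :: "'e \<Rightarrow> 'r :: linorder"
  assumes "finite \<B>" and "finite E"
    and "\<And>B. B \<in> \<B> \<Longrightarrow> c B \<in> E"
    and "\<And>B x. B \<in> \<B> \<Longrightarrow> x \<in> B \<Longrightarrow> \<rho> x < \<rho> (c B)"
    and "\<And>B A. B \<in> \<B> \<Longrightarrow> B \<subseteq> A \<Longrightarrow> A \<subseteq> E \<Longrightarrow> c B \<notin> A \<Longrightarrow> f A = - f (insert (c B) A)"
  shows "(\<Sum>A | A \<subseteq> E. f A) = (\<Sum>A | A \<subseteq> E \<and> (\<forall>B\<in>\<B>. \<not> B \<subseteq> A). f A)"
  using assms(1,3-)
\<comment> \<open>Each newly added \<open>B\<close> has a closing edge of rank at least that of all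
  earlier ones; ties occur when closing edges are shared.\<close>
proof (induction \<B> rule: finite_ranking_induct[where f = "\<lambda>B. \<rho> (c B)"])
  case (insert B \<B>)
  \<comment> \<open>The sets that survive \<open>\<B>\<close> but are excluded once \<open>B\<close>
    is added.\<close>
  define \<A> where "\<A> = {A. A \<subseteq> E \<and> (\<forall>B'\<in>\<B>. \<not> B' \<subseteq> A) \<and> B \<subseteq> A}"
  \<comment> \<open>Otherwise \<open>\<rho> (c B) < \<rho> (c B') \<le> \<rho> (c B)\<close>. Hence
    toggling \<open>c B\<close> never affects whether some \<open>B'\<close> is contained in a
    set.\<close>
  have notin: "c B \<notin> B'" if "B' \<in> insert B \<B>" for B'
    using insert.hyps(2) insert.prems(2)[of B' "c B"] that by fastforce
  have fin: "finite {A. A \<subseteq> E \<and> P A}" for P using \<open>finite E\<close> by simp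
  have "(\<Sum>A\<in>\<A>. f A) = 0"
  proof (rule sum_eq_0_by_toggling)
    show "finite \<A>" unfolding \<A>_def by (rule fin)
    fix A
    have "B' \<subseteq> A - {c B} \<longleftrightarrow> B' \<subseteq> insert (c B) A" if "B' \<in> insert B \<B>" for B'
      using notin[OF that] by blast
    moreover have "A - {c B} \<subseteq> E \<longleftrightarrow> insert (c B) A \<subseteq> E" using insert.prems(1) by blast
    ultimately show "A - {c B} \<in> \<A> \<longleftrightarrow> insert (c B) A \<in> \<A>" by (simp add: \<A>_def)
    show "f A = - f (insert (c B) A)" if "A \<in> \<A>" "c B \<notin> A"
      using that insert.prems(3)[of B A] by (simp add: \<A>_def)
  qed
  have "(\<Sum>A | A \<subseteq> E. f A) = (\<Sum>A | A \<subseteq> E \<and> (\<forall>B\<in>\<B>. \<not> B \<subseteq> A). f A)"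
    by (rule insert.IH) (simp_all add: insert.prems)
  also have "\<dots> = (\<Sum>A\<in>{A. A \<subseteq> E \<and> (\<forall>B\<in>insert B \<B>. \<not> B \<subseteq> A)} \<union> \<A>. f A)"
    by (rule sum.cong) (auto simp: \<A>_def)
  also have "\<dots> = (\<Sum>A | A \<subseteq> E \<and> (\<forall>B\<in>insert B \<B>. \<not> B \<subseteq> A). f A) + (\<Sum>A\<in>\<A>. f A)"
    unfolding \<A>_def by (intro sum.union_disjoint fin) auto
  finally show ?case by (simp add: \<open>(\<Sum>A\<in>\<A>. f A) = 0\<close>)
qed simp

text \<open>Counting predecessors turns the relation \<open>r\<close> into a numerical rank. The
  inequality is strict because \<open>x\<close> precedes \<open>y\<close> but not itself.\<close>

lemma card_predecessors_less:
  assumes "finite E" and "strict_linear_order_on E r" and "(x, y) \<in> r" and "x \<in> E"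
  shows "card {z \<in> E. (z, x) \<in> r} < card {z \<in> E. (z, y) \<in> r}"
proof (rule psubset_card_mono)
  have "trans r" "irrefl r" using assms(2) by (auto simp: strict_linear_order_on_def)
  then have "(z, y) \<in> r" if "(z, x) \<in> r" for z using assms(3) that by (blast dest: transD)
  moreover have "(x, x) \<notin> r" using \<open>irrefl r\<close> by (simp add: irrefl_def)
  ultimately show "{z \<in> E. (z, x) \<in> r} \<subset> {z \<in> E. (z, y) \<in> r}" using assms(3,4) by blast
qed (use assms(1) in simp)

theorem theorem10:
  fixes G :: "('v, 'e) pre_hypergraph"
    and r :: "('e \<times> 'e) set"
    and \<B> :: "'e set set"
    and f :: "'e set \<Rightarrow> 'g :: ab_group_add"
  assumes "hypergraph G"
    and "strict_linear_order_on (edges G) r"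
    and "\<B> \<subseteq> broken_cycles G r"
    and "\<And>A e. A \<subseteq> edges G \<Longrightarrow> e \<in> edges G - A \<Longrightarrow>
           num_components (spanning_subgraph G A) = num_components (spanning_subgraph G (A \<union> {e})) \<Longrightarrow>
           f A = - f (A \<union> {e})"
  shows "(\<Sum>A | A \<subseteq> edges G. f A) = (\<Sum>A | A \<subseteq> edges G \<and> (\<forall>B\<in>\<B>. \<not> B \<subseteq> A). f A)"
proof -
  have fin: "finite (edges G)" using assms(1) by (simp add: hypergraph_def)
  have "\<forall>B\<in>\<B>. \<exists>e C. B = edges C - {e} \<and> subgraph C G \<and> delta_cycle C \<and> e \<in> edges C \<and>
      (\<forall>e'\<in>edges C - {e}. (e', e) \<in> r)"
    using assms(3) unfolding broken_cycles_def by blast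
  \<comment> \<open>Different \<delta>-cycles may leave the same broken cycle, so one cycle
    \<open>D B\<close> with its maximal edge \<open>c B\<close> is chosen for each
    \<open>B\<close>.\<close>
  then obtain c D where cD: "\<And>B. B \<in> \<B> \<Longrightarrow> B = edges (D B) - {c B} \<and> subgraph (D B) G \<and>
      delta_cycle (D B) \<and> c B \<in> edges (D B) \<and> (\<forall>e'\<in>edges (D B) - {c B}. (e', c B) \<in> r)"
    by metis
  have E: "B \<subseteq> edges G \<and> c B \<in> edges G" if "B \<in> \<B>" for B
    using cD[OF that] by (auto simp: subgraph_def)
  show ?thesis
  proof (rule sum_subsets_eq_sum_avoiding[where c = c and \<rho> = "\<lambda>x. card {z \<in> edges G. (z, x) \<in> r}"])
    show "finite \<B>" using E fin by (meson finite_Pow_iff finite_subset PowI subsetI)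
    show "card {z \<in> edges G. (z, x) \<in> r} < card {z \<in> edges G. (z, c B) \<in> r}"
      if "B \<in> \<B>" "x \<in> B" for B x
      using that cD[OF that(1)] E[OF that(1)]
      by (intro card_predecessors_less[OF fin assms(2)]) auto
    show "f A = - f (insert (c B) A)" if "B \<in> \<B>" "B \<subseteq> A" "A \<subseteq> edges G" "c B \<notin> A" for B A
    proof -
      have "num_components (spanning_subgraph G A) =
          num_components (spanning_subgraph G (insert (c B) A))"
        using cD[OF that(1)] that(2,3)
        by (intro num_components_insert_closing_edge[OF assms(1), of "D B"]) auto
      then show ?thesis using assms(4)[of A "c B"] E that by simp
    qed
  qed (use fin E in auto)
qed

end
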